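(* Let $\rho\colon\mathbb S\to\mathbb C$ satisfy $\sum_{\lambda\in\mathbb S}|\rho(\lambda)|<\infty$, and let $g=\Sigma(\rho)^+$ be the corresponding inner Poincaré simple pole series, a holomorphic function on $\mathbb D$. Then $g$ is uniquely rrl-continuable, and its rrl-continuation is the associated outer Poincaré simple pole series $\Sigma(\rho)^-$.
   Context: Notation: $\mathbb D=\{z\in\mathbb C: |z|<1\}$, $\mathbb E=\{z\in\mathbb C:|z|>1\}\cup\{\infty\}\subset\widehat{\mathbb C}$, $\mathbb S=\{z\in\mathbb C:|z|=1\}$. PSP-series: for $\rho\colon\mathbb S\to\mathbb C$ with $\sum_{\lambda\in\mathbb S}|\rho(\lambda)|<\infty$ (so $\rho$ has countable support), put $\Sigma(\rho)(z)=\sum_{\lambda\in\mathbb S}\frac{\rho(\lambda)}{z-\lambda}$ for $z\in\mathbb D\cup\mathbb E$ (with value $0$ at $\infty$). The inner PSP-series is $\Sigma(\rho)^+=\Sigma(\rho)|_{\mathbb D}$ and the associated outer PSP-series is $\Sigma(\rho)^-=\Sigma(\rho)|_{\mathbb E}$; both are holomorphic. Right limits: a right limit of a bounded sequence $(a_k)_{k\ge0}$ of complex numbers is a two-sided sequence $(b_n)_{n\in\mathbb Z}$ for which there is a strictly increasing sequence of positive integers $(k_j)_{j\ge1}$ with $\lim_{j\to\infty}a_{n+k_j}=b_n$ for every $n\in\mathbb Z$. It is renascent if $b_n=a_n$ for all $n\ge0$. rrl-continuation: a holomorphic function $g(z)=\sum_{k\ge0}a_kz^k$ on $\mathbb D$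 with bounded $(a_k)$ is rrl-continuable if $(a_k)$ has a renascent right limit $(b_n)_{n\in\mathbb Z}$; then the function $z\mapsto-\sum_{n<0}b_nz^n$ on $\mathbb E$ is called an rrl-continuation of $g$. The function $g$ is uniquely rrl-continuable if it has exactly one rrl-continuation. *)

theory Defs
  imports "HOL-Complex_Analysis.Complex_Analysis"
begin

text \<open>The Riemann sphere is the type \<open>complex option\<close>, with \<open>None\<close> as the point at infinity
  (the encoding used by the library's \<open>Alexandroff_compactification\<close>).\<close>

abbreviation unit_disc :: "complex set" where
  "unit_disc \<equiv> ball 0 1"

abbreviation unit_circle :: "complex set" where
  "unit_circle \<equiv> sphere 0 1"

definition outer_disc :: "complex option set" where
  "outer_disc = insert None (Some ` {z. norm z > 1})"

definition psp :: "(complex \<Rightarrow> complex) \<Rightarrow> complex option \<Rightarrow> complex" where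
  "psp \<rho> w = (case w of None \<Rightarrow> 0 | Some z \<Rightarrow> (\<Sum>\<^sub>\<infinity>l\<in>unit_circle. \<rho> l / (z - l)))"

text \<open>Functions with a given domain are extensional (\<open>undefined\<close> off the domain), so that equality
  of such functions is equality on the domain.\<close>

definition psp_inner :: "(complex \<Rightarrow> complex) \<Rightarrow> complex \<Rightarrow> complex" where
  "psp_inner \<rho> = restrict (\<lambda>z. psp \<rho> (Some z)) unit_disc"

definition psp_outer :: "(complex \<Rightarrow> complex) \<Rightarrow> complex option \<Rightarrow> complex" where
  "psp_outer \<rho> = restrict (psp \<rho>) outer_disc"

text \<open>For fixed \<open>n\<close> the index \<open>n + k j\<close> is negative for only finitely many \<open>j\<close>, so the truncation
  performed by \<open>nat\<close> does not affect the limit.\<close>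

definition right_limit :: "(nat \<Rightarrow> complex) \<Rightarrow> (int \<Rightarrow> complex) \<Rightarrow> bool" where
  "right_limit a b \<longleftrightarrow> bounded (range a) \<and>
     (\<exists>k :: nat \<Rightarrow> nat. strict_mono k \<and> (\<forall>j. k j > 0) \<and>
        (\<forall>n. (\<lambda>j. a (nat (n + int (k j)))) \<longlonglongrightarrow> b n))"

definition renascent_right_limit :: "(nat \<Rightarrow> complex) \<Rightarrow> (int \<Rightarrow> complex) \<Rightarrow> bool" where
  "renascent_right_limit a b \<longleftrightarrow> right_limit a b \<and> (\<forall>n. b (int n) = a n)"

definition bounded_power_series :: "(complex \<Rightarrow> complex) \<Rightarrow> (nat \<Rightarrow> complex) \<Rightarrow> bool" where
  "bounded_power_series g a \<longleftrightarrow> g holomorphic_on unit_disc \<and> bounded (range a) \<and>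
     (\<forall>z\<in>unit_disc. (\<lambda>k. a k * z ^ k) sums g z)"

text \<open>At infinity every \<open>z powi n\<close> with \<open>n < 0\<close> vanishes, whence the value \<open>0\<close> there.\<close>

definition outer_series :: "(int \<Rightarrow> complex) \<Rightarrow> complex option \<Rightarrow> complex" where
  "outer_series b = restrict
     (\<lambda>w. case w of None \<Rightarrow> 0 | Some z \<Rightarrow> - (\<Sum>\<^sub>\<infinity>n\<in>{..<0::int}. b n * z powi n)) outer_disc"

definition rrl_continuable :: "(complex \<Rightarrow> complex) \<Rightarrow> bool" where
  "rrl_continuable g \<longleftrightarrow> (\<exists>a b. bounded_power_series g a \<and> renascent_right_limit a b)"

definition rrl_continuation :: "(complex \<Rightarrow> complex) \<Rightarrow> (complex option \<Rightarrow> complex) \<Rightarrow> bool" where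
  "rrl_continuation g h \<longleftrightarrow>
     (\<exists>a b. bounded_power_series g a \<and> renascent_right_limit a b \<and> h = outer_series b)"

definition uniquely_rrl_continuable :: "(complex \<Rightarrow> complex) \<Rightarrow> bool" where
  "uniquely_rrl_continuable g \<longleftrightarrow> rrl_continuable g \<and> (\<exists>!h. rrl_continuation g h)"

end

theory Submission
  imports Defs
begin

text \<open>Expanding each pole, the inner series has the Taylor coefficients
  \<open>c n = - (\<Sum>l. \<rho> l * l powi (- n - 1))\<close>, and the same formula at negative \<open>n\<close> gives the expansion of
  the outer series at infinity. On \<open>\<int>\<close> the sequence \<open>c\<close> is uniformly almost periodic: some arbitrarily
  large \<open>K\<close> brings \<open>l ^ K\<close> near \<open>1\<close> for the finitely many \<open>l\<close> that carry most of the mass of \<open>\<rho>\<close>.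
  Translating along such \<open>K\<close> shows that \<open>c\<close> is a renascent right limit of its own nonnegative part.
  Conversely, every right limit inherits the almost periods of the sequence. So a renascent one agrees
  at \<open>n < 0\<close>, up to \<open>\<epsilon>\<close>, with \<open>c (n + K)\<close>, hence with \<open>c n\<close>.\<close>

section \<open>Auxiliary facts on sums and power series\<close>

lemma has_sum_diff:
  fixes f g :: "'a \<Rightarrow> 'b :: topological_ab_group_add"
  assumes "(f has_sum S) A" "(g has_sum T) A"
  shows "((\<lambda>x. f x - g x) has_sum (S - T)) A"
  using has_sum_add[OF assms(1), of "\<lambda>x. - g x" "- T"] assms(2) by (simp add: has_sum_uminus)

text \<open>The coefficientwise difference expands the zero function. Its value at \<open>0\<close>
  rules out a nonzero constant term; a nonzero coefficient of positive index would make
  \<open>0\<close> an isolated zero, which the zero function does not have.\<close>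

lemma powser_coeffs_unique:
  fixes a b :: "nat \<Rightarrow> complex"
  assumes "r > 0" and a: "\<And>z. z \<in> ball 0 r \<Longrightarrow> (\<lambda>k. a k * z ^ k) sums f z"
    and b: "\<And>z. z \<in> ball 0 r \<Longrightarrow> (\<lambda>k. b k * z ^ k) sums f z"
  shows "a = b"
proof (rule ccontr)
  assume "a \<noteq> b"
  then obtain m where "a m \<noteq> b m" by auto
  define d where "d = (\<lambda>k. a k - b k)"
  have dm: "d m \<noteq> 0" using \<open>a m \<noteq> b m\<close> by (simp add: d_def)
  have d: "(\<lambda>k. d k * (z - 0) ^ k) sums 0" if "z \<in> ball 0 r" for z
    using sums_diff[OF a[OF that] b[OF that]] by (simp add: d_def algebra_simps)
  show False
  proof (cases "m = 0")
    case True
    have "(\<lambda>k. d k * 0 ^ k) sums 0" using d[of 0] \<open>r > 0\<close> by simp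
    then have "d 0 = 0" using powser_sums_zero_iff by blast
    with dm True show False by simp
  next
    case False
    have d': "(\<lambda>k. d k * (z - 0) ^ k) sums 0" if "norm (z - 0) < r" for z
      using d[of z] that by simp
    have "m > 0" using False by simp
    show False
    proof (rule powser_0_nonzero[where f = "\<lambda>_. 0", OF \<open>r > 0\<close> d' refl dm \<open>m > 0\<close>])
      fix s :: real
      assume "0 < s" and nz: "\<And>z :: complex. z \<in> cball 0 s - {0} \<Longrightarrow> (0 :: complex) \<noteq> 0"
      then have "(of_real s :: complex) \<in> cball 0 s - {0}" by simp
      from nz[OF this] show False by simp
    qed
  qed
qed

text \<open>Fubini for the family \<open>c l * u l ^ k * q ^ k\<close>, whose norms
  \<open>norm (c l) * norm q ^ k\<close> are summable: summing over \<open>k\<close> first gives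
  geometric series, summing over \<open>l\<close> first gives the coefficients. It serves both
  expansions, with \<open>u l = inverse l\<close>, \<open>q = z\<close> in the disc and
  \<open>u l = l\<close>, \<open>q = inverse z\<close> outside.\<close>

lemma geometric_transform_has_sum:
  fixes c u :: "'a \<Rightarrow> complex"
  assumes c: "(\<lambda>l. norm (c l)) summable_on A"
    and u: "\<And>l. l \<in> A \<Longrightarrow> norm (u l) = 1" and q: "norm q < 1"
  shows "((\<lambda>k::nat. (\<Sum>\<^sub>\<infinity>l\<in>A. c l * u l ^ k) * q ^ k) has_sum (\<Sum>\<^sub>\<infinity>l\<in>A. c l / (1 - q * u l))) UNIV"
proof -
  define f where "f = (\<lambda>(l, k::nat). c l * u l ^ k * q ^ k)"
  have geo: "((\<lambda>k::nat. norm q ^ k) has_sum (1 / (1 - norm q))) UNIV"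
    using norm_summable_imp_has_sum[OF _ geometric_sums[of "norm q"]] q
    by (simp add: norm_power summable_geometric)
  have nf: "norm (f (l, k)) = norm (c l) * norm q ^ k" if "l \<in> A" for l k
    using u[OF that] by (simp add: f_def norm_mult norm_power)
  have rows: "((\<lambda>k. norm (f (l, k))) has_sum (norm (c l) * (1 / (1 - norm q)))) UNIV" if "l \<in> A" for l
    unfolding nf[OF that] by (rule has_sum_cmult_right[OF geo])
  have sf: "f summable_on (A \<times> UNIV)"
    by (rule abs_summable_summable, rule summable_on_SigmaI[OF rows])
      (use summable_on_cmult_left[OF c, of "1 / (1 - norm q)"] in auto)
  have "((\<lambda>k. f (l, k)) has_sum (c l / (1 - q * u l))) UNIV" if l: "l \<in> A" for l
  proof -
    have n: "norm (q * u l) < 1" using q u[OF l] by (simp add: norm_mult)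
    have "((\<lambda>k. (q * u l) ^ k) has_sum (1 / (1 - q * u l))) UNIV"
      by (rule norm_summable_imp_has_sum[OF _ geometric_sums[OF n]])
        (use n in \<open>simp add: norm_power summable_geometric del: norm_mult\<close>)
    from has_sum_cmult_right[OF this, of "c l"] show ?thesis
      by (simp add: f_def power_mult_distrib mult_ac)
  qed
  then have "((\<lambda>l. c l / (1 - q * u l)) has_sum infsum f (A \<times> UNIV)) A"
    by (rule has_sum_SigmaD[OF has_sum_infsum[OF sf]])
  then have S: "(f has_sum (\<Sum>\<^sub>\<infinity>l\<in>A. c l / (1 - q * u l))) (A \<times> UNIV)"
    using sf by (simp add: infsumI)
  have "((\<lambda>(k, l). f (l, k)) has_sum (\<Sum>\<^sub>\<infinity>l\<in>A. c l / (1 - q * u l))) (UNIV \<times> A)"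
    using S by (subst has_sum_reindex_bij_witness[where i = prod.swap and j = prod.swap]) auto
  moreover have "((\<lambda>l. f (l, k)) has_sum ((\<Sum>\<^sub>\<infinity>l\<in>A. c l * u l ^ k) * q ^ k)) A" for k
  proof -
    have "(\<lambda>l. c l * u l ^ k) summable_on A"
      by (rule abs_summable_summable, rule Infinite_Sum.abs_summable_on_comparison_test'[OF c])
        (simp add: norm_mult norm_power u)
    then show ?thesis by (auto simp: f_def intro!: has_sum_cmult_left has_sum_infsum)
  qed
  ultimately show ?thesis
    by (intro has_sum_SigmaD[where f = "\<lambda>(k, l). f (l, k)"]) auto
qed

section \<open>Simultaneous approximation on the circle\<close>

text \<open>By compactness some subsequence of exponents makes all the finitely many sequences of
  powers converge. Two late exponents then give nearly equal powers, and since
  \<open>norm l = 1\<close>, their difference is an exponent with powers near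
  \<open>1\<close>.\<close>

lemma unimodular_powers_near_1:
  fixes F :: "complex set"
  assumes "finite F" "F \<subseteq> sphere 0 1" "\<delta> > 0"
  shows "\<exists>K\<ge>N. \<forall>l\<in>F. norm (l ^ K - 1) < \<delta>"
proof -
  have "\<exists>r :: nat \<Rightarrow> nat. strict_mono r \<and> (\<forall>l\<in>F. convergent (\<lambda>j. l ^ r j))"
    using assms(1,2)
  proof (induction F)
    case empty
    show ?case using strict_mono_id by auto
  next
    case (insert x F)
    then obtain r :: "nat \<Rightarrow> nat" where r: "strict_mono r" "\<forall>l\<in>F. convergent (\<lambda>j. l ^ r j)" by auto
    have "\<forall>j. x ^ r j \<in> sphere 0 1" using insert.prems by (simp add: norm_power)
    \<comment> \<open>Thinning out \<open>r\<close> by \<open>s\<close> keeps the limits already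
      obtained on \<open>F\<close> and adds one at \<open>x\<close>.\<close>
    then obtain y s where s: "strict_mono s" "(\<lambda>j. x ^ r (s j)) \<longlonglongrightarrow> y"
      using compact_sphere[of "0 :: complex" 1, unfolded compact_def, rule_format, of "\<lambda>j. x ^ r j"]
      by (auto simp: o_def)
    have "\<forall>l\<in>insert x F. convergent (\<lambda>j. l ^ (r \<circ> s) j)"
      using r(2) s convergent_subseq_convergent[OF _ s(1)] by (auto simp: o_def convergent_def)
    then show ?case using strict_mono_o[OF r(1) s(1)] by blast
  qed
  then obtain r :: "nat \<Rightarrow> nat" where r: "strict_mono r" "\<And>l. l \<in> F \<Longrightarrow> Cauchy (\<lambda>j. l ^ r j)"
    by (auto simp: convergent_Cauchy)
  have "\<forall>l\<in>F. \<forall>\<^sub>F M in sequentially. \<forall>m\<ge>M. norm (l ^ r m - l ^ r M) < \<delta>"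
  proof
    fix l assume "l \<in> F"
    from r(2)[OF this] \<open>\<delta> > 0\<close> obtain M where "\<And>m n. m \<ge> M \<Longrightarrow> n \<ge> M \<Longrightarrow> norm (l ^ r m - l ^ r n) < \<delta>"
      by (metis CauchyD)
    then show "\<forall>\<^sub>F M in sequentially. \<forall>m\<ge>M. norm (l ^ r m - l ^ r M) < \<delta>"
      unfolding eventually_sequentially by (meson order_trans)
  qed
  then have "\<forall>\<^sub>F M in sequentially. \<forall>l\<in>F. \<forall>m\<ge>M. norm (l ^ r m - l ^ r M) < \<delta>"
    using assms(1) by (simp add: eventually_ball_finite_distrib)
  then obtain M where M: "\<And>l m. l \<in> F \<Longrightarrow> m \<ge> M \<Longrightarrow> norm (l ^ r m - l ^ r M) < \<delta>"
    by (auto simp: eventually_sequentially)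
  \<comment> \<open>As \<open>r m \<ge> m\<close>, this choice gives \<open>m \<ge> M\<close> and
    \<open>r m \<ge> r M + N\<close>: the natural subtraction \<open>r m - r M\<close> does not
    truncate, and its value is at least \<open>N\<close>.\<close>
  define m where "m = M + r M + N"
  have rm: "r m \<ge> m" using seq_suble[OF r(1)] .
  have "norm (l ^ (r m - r M) - 1) < \<delta>" if "l \<in> F" for l
  proof -
    have "l ^ r m - l ^ r M = l ^ r M * (l ^ (r m - r M) - 1)"
      using rm by (simp add: m_def algebra_simps flip: power_add)
    moreover have "norm l = 1" using that assms(2) by auto
    ultimately show ?thesis using M[OF that, of m] by (simp add: m_def norm_mult norm_power)
  qed
  moreover have "r m - r M \<ge> N" using rm by (simp add: m_def)
  ultimately show ?thesis by blast
qed

section \<open>The two-sided coefficient sequence and its almost periods\<close>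

text \<open>These are the Fourier coefficients of the atomic measure on the circle with mass
  \<open>- \<rho> l / l\<close> at \<open>l\<close>.\<close>

definition psp_coeff :: "(complex \<Rightarrow> complex) \<Rightarrow> int \<Rightarrow> complex" where
  "psp_coeff \<rho> n = - (\<Sum>\<^sub>\<infinity>l\<in>unit_circle. \<rho> l * l powi (- n - 1))"

context
  fixes \<rho> :: "complex \<Rightarrow> complex"
  assumes rho: "(\<lambda>l. norm (\<rho> l)) summable_on unit_circle"
begin

lemma psp_coeff_has_sum:
  "((\<lambda>l. \<rho> l * l powi (- n - 1)) has_sum (- psp_coeff \<rho> n)) unit_circle"
proof -
  have "(\<lambda>l. \<rho> l * l powi (- n - 1)) summable_on unit_circle"
    by (rule abs_summable_summable, rule Infinite_Sum.abs_summable_on_comparison_test'[OF rho])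
      (simp add: norm_mult norm_power_int)
  then show ?thesis by (simp add: psp_coeff_def)
qed

lemma norm_psp_coeff_le: "norm (psp_coeff \<rho> n) \<le> (\<Sum>\<^sub>\<infinity>l\<in>unit_circle. norm (\<rho> l))"
proof -
  have "norm (- psp_coeff \<rho> n) \<le> (\<Sum>\<^sub>\<infinity>l\<in>unit_circle. norm (\<rho> l))"
    by (rule norm_infsum_le[OF psp_coeff_has_sum has_sum_infsum[OF rho]])
      (simp add: norm_mult norm_power_int)
  then show ?thesis by simp
qed

text \<open>A shift by \<open>K\<close> changes the term at \<open>l\<close> by
  \<open>norm (\<rho> l) * norm (l ^ K - 1)\<close>, whatever \<open>n\<close> is. The second factor
  is below \<open>\<delta>\<close> on a finite set \<open>F\<close> and at most \<open>2\<close>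
  elsewhere, where little mass is left.\<close>

lemma psp_coeff_almost_periodic:
  assumes "\<epsilon> > 0"
  shows "\<exists>K\<ge>N. \<forall>n. norm (psp_coeff \<rho> (n + int K) - psp_coeff \<rho> n) \<le> \<epsilon>"
proof -
  define S where "S = (\<Sum>\<^sub>\<infinity>l\<in>unit_circle. norm (\<rho> l))"
  have S: "((\<lambda>l. norm (\<rho> l)) has_sum S) unit_circle" using rho by (simp add: S_def)
  have "S \<ge> 0" unfolding S_def by (rule infsum_nonneg) simp
  obtain F where F: "finite F" "F \<subseteq> unit_circle" "dist (\<Sum>l\<in>F. norm (\<rho> l)) S \<le> \<epsilon> / 4"
    using has_sum_finite_approximation[OF S, of "\<epsilon> / 4"] assms by auto
  \<comment> \<open>The tail off \<open>F\<close> costs at most \<open>2 * (\<epsilon> / 4)\<close>,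
    so \<open>\<delta> * S\<close> may use the other half of \<open>\<epsilon>\<close>. The summand
    \<open>1\<close> keeps the denominator positive when \<open>S = 0\<close>.\<close>
  define \<delta> where "\<delta> = \<epsilon> / (2 * (S + 1))"
  have "\<delta> > 0" using assms \<open>S \<ge> 0\<close> by (simp add: \<delta>_def)
  obtain K where K: "K \<ge> N" "\<And>l. l \<in> F \<Longrightarrow> norm (l ^ K - 1) < \<delta>"
    using unimodular_powers_near_1[OF F(1,2) \<open>\<delta> > 0\<close>] by blast
  have "norm (psp_coeff \<rho> (n + int K) - psp_coeff \<rho> n) \<le> \<epsilon>" for n
  proof -
    let ?T = "\<lambda>l. if l \<in> F then norm (\<rho> l) else 0"
    have T: "(?T has_sum (\<Sum>l\<in>F. norm (\<rho> l))) unit_circle"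
      using has_sum_finite_neutralI[of F unit_circle ?T] F(1,2) by simp
    \<comment> \<open>A majorant on the whole circle: its first part is twice the mass off
      \<open>F\<close> and vanishes on \<open>F\<close>, its second part controls the terms in
      \<open>F\<close>.\<close>
    have B: "((\<lambda>l. 2 * (norm (\<rho> l) - ?T l) + \<delta> * norm (\<rho> l)) has_sum
        (2 * (S - (\<Sum>l\<in>F. norm (\<rho> l))) + \<delta> * S)) unit_circle"
      by (intro has_sum_add has_sum_cmult_right has_sum_diff S T)
    have "norm (- psp_coeff \<rho> n - - psp_coeff \<rho> (n + int K)) \<le> 2 * (S - (\<Sum>l\<in>F. norm (\<rho> l))) + \<delta> * S"
    proof (rule norm_infsum_le[OF has_sum_diff[OF psp_coeff_has_sum psp_coeff_has_sum] B])
      fix l assume l: "l \<in> unit_circle"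
      then have [simp]: "norm l = 1" "l \<noteq> 0" by auto
      \<comment> \<open>Factoring out the shifted term, rather than the unshifted one, leaves the
        nonnegative power \<open>l ^ K\<close>.\<close>
      have "l powi (- n - 1) = l powi (- (n + int K) - 1) * l ^ K"
        by (simp flip: power_int_of_nat power_int_add)
      then have "\<rho> l * l powi (- n - 1) - \<rho> l * l powi (- (n + int K) - 1)
          = \<rho> l * l powi (- (n + int K) - 1) * (l ^ K - 1)"
        by (simp add: algebra_simps)
      then have *: "norm (\<rho> l * l powi (- n - 1) - \<rho> l * l powi (- (n + int K) - 1))
          = norm (\<rho> l) * norm (l ^ K - 1)"
        by (simp add: norm_mult norm_power_int)
      have 2: "norm (l ^ K - 1) \<le> 2"
        using norm_triangle_ineq4[of "l ^ K" 1] by (simp add: norm_power)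
      show "norm (\<rho> l * l powi (- n - 1) - \<rho> l * l powi (- (n + int K) - 1))
          \<le> 2 * (norm (\<rho> l) - ?T l) + \<delta> * norm (\<rho> l)"
      proof (cases "l \<in> F")
        case True
        then show ?thesis unfolding *
          using mult_left_mono[OF less_imp_le[OF K(2)[OF True]], of "norm (\<rho> l)"] by (simp add: mult.commute)
      next
        case False
        have "0 \<le> \<delta> * norm (\<rho> l)" using \<open>\<delta> > 0\<close> by simp
        with False show ?thesis unfolding *
          using mult_left_mono[OF 2, of "norm (\<rho> l)"] by simp
      qed
    qed
    moreover have "S - (\<Sum>l\<in>F. norm (\<rho> l)) \<le> \<epsilon> / 4" using F(3) unfolding dist_real_def by linarith
    moreover have "\<delta> * S \<le> \<epsilon> / 2"
      using assms \<open>S \<ge> 0\<close> by (simp add: \<delta>_def field_simps)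
    ultimately show ?thesis by (simp add: norm_minus_commute)
  qed
  with K(1) show ?thesis by blast
qed

section \<open>Expansions at the origin and at infinity\<close>

lemma psp_inner_sums:
  assumes "z \<in> unit_disc"
  shows "(\<lambda>k. psp_coeff \<rho> (int k) * z ^ k) sums psp_inner \<rho> z"
proof -
  have z: "norm z < 1" using assms by simp
  \<comment> \<open>The weights come from writing \<open>1 / (z - l)\<close> as
    \<open>(- 1 / l) / (1 - z * inverse l)\<close>.\<close>
  have c: "(\<lambda>l. norm (- \<rho> l / l)) summable_on unit_circle"
    by (rule Infinite_Sum.abs_summable_on_comparison_test'[OF rho]) (simp add: norm_divide)
  have "((\<lambda>k. (\<Sum>\<^sub>\<infinity>l\<in>unit_circle. - \<rho> l / l * inverse l ^ k) * z ^ k) has_sum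
      (\<Sum>\<^sub>\<infinity>l\<in>unit_circle. - \<rho> l / l / (1 - z * inverse l))) UNIV"
    by (rule geometric_transform_has_sum[OF c _ z]) (simp add: norm_inverse)
  moreover have "(\<Sum>\<^sub>\<infinity>l\<in>unit_circle. - \<rho> l / l * inverse l ^ k) = psp_coeff \<rho> (int k)" for k
  proof -
    have "- \<rho> l / l * inverse l ^ k = - (\<rho> l * l powi (- int k - 1))" if "l \<in> unit_circle" for l
      using that by (auto simp: power_int_diff power_int_minus field_simps)
    then show ?thesis unfolding psp_coeff_def infsum_uminus[symmetric] by (intro infsum_cong)
  qed
  moreover have "(\<Sum>\<^sub>\<infinity>l\<in>unit_circle. - \<rho> l / l / (1 - z * inverse l)) = psp_inner \<rho> z"
  proof -
    have "- \<rho> l / l / (1 - z * inverse l) = \<rho> l / (z - l)" if "l \<in> unit_circle" for l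
    proof -
      have "l \<noteq> 0" "z \<noteq> l" using that z by auto
      then show ?thesis by (simp add: divide_simps) (simp add: algebra_simps)
    qed
    then have "(\<Sum>\<^sub>\<infinity>l\<in>unit_circle. - \<rho> l / l / (1 - z * inverse l)) = (\<Sum>\<^sub>\<infinity>l\<in>unit_circle. \<rho> l / (z - l))"
      by (rule infsum_cong)
    then show ?thesis using assms by (simp add: psp_inner_def psp_def)
  qed
  ultimately show ?thesis by (simp add: has_sum_imp_sums)
qed

lemma bounded_power_series_psp_inner:
  "bounded_power_series (psp_inner \<rho>) (\<lambda>k. psp_coeff \<rho> (int k))"
  unfolding bounded_power_series_def
proof (intro conjI ballI)
  show "psp_inner \<rho> holomorphic_on unit_disc"
    using power_series_holomorphic[of 0 1 "\<lambda>k. psp_coeff \<rho> (int k)"] psp_inner_sums by simp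
  show "bounded (range (\<lambda>k. psp_coeff \<rho> (int k)))"
    using norm_psp_coeff_le by (auto simp: bounded_iff)
qed (rule psp_inner_sums)

text \<open>\<open>rrl_continuation\<close> quantifies existentially over the coefficient sequence;
  pinning it down reduces uniqueness to that of the right limit.\<close>

lemma bounded_power_series_psp_inner_unique:
  assumes "bounded_power_series (psp_inner \<rho>) a"
  shows "a = (\<lambda>k. psp_coeff \<rho> (int k))"
proof (rule powser_coeffs_unique)
  show "(\<lambda>k. a k * z ^ k) sums psp_inner \<rho> z" if "z \<in> unit_disc" for z
    using assms that unfolding bounded_power_series_def by blast
qed (rule zero_less_one, rule psp_inner_sums)

text \<open>For \<open>norm z > 1\<close> each pole \<open>1 / (z - l)\<close> is
  \<open>inverse z\<close> times the geometric series in \<open>l / z\<close>.\<close>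

lemma outer_series_psp_coeff: "outer_series (psp_coeff \<rho>) = psp_outer \<rho>"
proof -
  have "- (\<Sum>\<^sub>\<infinity>n\<in>{..<0::int}. psp_coeff \<rho> n * z powi n) = psp \<rho> (Some z)" if z: "norm z > 1" for z
  proof -
    have z0: "z \<noteq> 0" and q: "norm (inverse z) < 1" using z by (auto simp: norm_inverse inverse_less_1_iff)
    let ?S = "\<Sum>\<^sub>\<infinity>l\<in>unit_circle. \<rho> l / (1 - inverse z * l)"
    have "((\<lambda>k. (\<Sum>\<^sub>\<infinity>l\<in>unit_circle. \<rho> l * l ^ k) * inverse z ^ k) has_sum ?S) UNIV"
      by (rule geometric_transform_has_sum[OF rho _ q]) simp
    then have "((\<lambda>k. inverse z * ((\<Sum>\<^sub>\<infinity>l\<in>unit_circle. \<rho> l * l ^ k) * inverse z ^ k)) has_sum (inverse z * ?S)) UNIV"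
      by (rule has_sum_cmult_right)
    then have "((\<lambda>n. - (psp_coeff \<rho> n * z powi n)) has_sum (inverse z * ?S)) {..<0}"
    \<comment> \<open>Under \<open>n = - k - 1\<close> the exponent \<open>- n - 1\<close> of
      \<open>l\<close> becomes \<open>k\<close>, and \<open>z powi n\<close> supplies the extra
      factor \<open>inverse z\<close>.\<close>
    proof (rule has_sum_reindex_bij_witness[where i = "\<lambda>n. nat (- n - 1)" and j = "\<lambda>k. - int k - 1", THEN iffD1, rotated -1])
      fix k :: nat
      show "- (psp_coeff \<rho> (- int k - 1) * z powi (- int k - 1))
          = inverse z * ((\<Sum>\<^sub>\<infinity>l\<in>unit_circle. \<rho> l * l ^ k) * inverse z ^ k)"
        using z0 by (simp add: psp_coeff_def power_int_diff power_int_minus field_simps)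
    qed auto
    then have "- (\<Sum>\<^sub>\<infinity>n\<in>{..<0::int}. psp_coeff \<rho> n * z powi n) = inverse z * ?S"
      unfolding infsum_uminus[symmetric] by (rule infsumI)
    also have "\<dots> = (\<Sum>\<^sub>\<infinity>l\<in>unit_circle. inverse z * (\<rho> l / (1 - inverse z * l)))"
      by (rule infsum_cmult_right'[symmetric])
    also have "\<dots> = psp \<rho> (Some z)"
      unfolding psp_def option.case
    proof (rule infsum_cong)
      fix l assume "l \<in> unit_circle"
      then have "z \<noteq> l" using z by auto
      then show "inverse z * (\<rho> l / (1 - inverse z * l)) = \<rho> l / (z - l)"
        using z0 by (simp add: divide_simps)
    qed
    finally show ?thesis .
  qed
  \<comment> \<open>At infinity both functions are \<open>0\<close> by definition.\<close>
  then show ?thesis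
    unfolding outer_series_def psp_outer_def
    by (intro restrict_ext) (auto simp: outer_disc_def psp_def)
qed

section \<open>Existence and uniqueness of the renascent right limit\<close>

lemma renascent_psp_coeff: "renascent_right_limit (\<lambda>k. psp_coeff \<rho> (int k)) (psp_coeff \<rho>)"
proof -
  let ?P = "\<lambda>j K. K > 0 \<and> (\<forall>n. norm (psp_coeff \<rho> (n + int K) - psp_coeff \<rho> n) \<le> inverse (real (Suc j)))"
  have step: "\<exists>K. ?P j K \<and> M < K" for j M
    \<comment> \<open>The lower bound \<open>Suc M\<close> yields both \<open>K > M\<close> and
      \<open>K > 0\<close>.\<close>
    using psp_coeff_almost_periodic[of "inverse (real (Suc j))" "Suc M"]
    by (metis Suc_le_eq inverse_positive_iff_positive of_nat_0_less_iff zero_less_Suc gr0I not_less0)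
  obtain k where k: "\<And>j. ?P j (k j)" "\<And>j. k j < k (Suc j)"
    using dependent_nat_choice[of ?P "\<lambda>_ M K. M < K"] step by metis
  have "(\<lambda>j. psp_coeff \<rho> (int (nat (n + int (k j))))) \<longlonglongrightarrow> psp_coeff \<rho> n" for n
  proof -
    have mono: "strict_mono k" using k(2) by (simp add: strict_mono_Suc_iff)
    have "(\<lambda>j. psp_coeff \<rho> (n + int (k j)) - psp_coeff \<rho> n) \<longlonglongrightarrow> 0"
      by (rule Lim_null_comparison[OF _ LIMSEQ_inverse_real_of_nat]) (use k(1) in auto)
    then have "(\<lambda>j. psp_coeff \<rho> (n + int (k j))) \<longlonglongrightarrow> psp_coeff \<rho> n" by (rule LIM_zero_cancel)
    moreover have "\<forall>\<^sub>F j in sequentially. psp_coeff \<rho> (n + int (k j)) = psp_coeff \<rho> (int (nat (n + int (k j))))"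
    \<comment> \<open>Since \<open>k j \<ge> j\<close>, from this index on \<open>n + k j\<close> is
      nonnegative and \<open>nat\<close> does not truncate.\<close>
    proof (rule eventually_sequentiallyI[of "nat (- n)"])
      fix j assume "j \<ge> nat (- n)"
      with seq_suble[OF mono, of j] have "n + int (k j) \<ge> 0" by linarith
      then show "psp_coeff \<rho> (n + int (k j)) = psp_coeff \<rho> (int (nat (n + int (k j))))" by simp
    qed
    ultimately show ?thesis by (rule Lim_transform_eventually)
  qed
  moreover have "bounded (range (\<lambda>k. psp_coeff \<rho> (int k)))"
    using norm_psp_coeff_le by (auto simp: bounded_iff)
  ultimately show ?thesis
    unfolding renascent_right_limit_def right_limit_def using k by (auto simp: strict_mono_Suc_iff)
qed

text \<open>The almost period inequality for the sequence passes to the limit \<open>b\<close>, also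
  at negative indices. An almost period \<open>K\<close> thus links \<open>b n\<close> to
  \<open>b (n + K)\<close>, which is a known coefficient once \<open>n + K \<ge> 0\<close>, and that
  coefficient is close to \<open>psp_coeff \<rho> n\<close>.\<close>

lemma renascent_psp_coeff_unique:
  assumes "renascent_right_limit (\<lambda>k. psp_coeff \<rho> (int k)) b"
  shows "b = psp_coeff \<rho>"
proof
  fix n
  from assms obtain k :: "nat \<Rightarrow> nat" where mono: "strict_mono k"
    and lim: "\<And>n. (\<lambda>j. psp_coeff \<rho> (int (nat (n + int (k j))))) \<longlonglongrightarrow> b n"
    and b: "\<And>n. b (int n) = psp_coeff \<rho> (int n)"
    unfolding renascent_right_limit_def right_limit_def by blast
  have "norm (b n - psp_coeff \<rho> n) \<le> \<epsilon>" if "\<epsilon> > 0" for \<epsilon>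
  proof -
    \<comment> \<open>The lower bound moves \<open>n + K\<close> into the range where
      \<open>b\<close> is prescribed; the error is spent once on \<open>b\<close> and once on
      \<open>psp_coeff \<rho>\<close>.\<close>
    obtain K where K: "K \<ge> nat (- n)"
      "\<And>n. norm (psp_coeff \<rho> (n + int K) - psp_coeff \<rho> n) \<le> \<epsilon> / 2"
      using psp_coeff_almost_periodic[of "\<epsilon> / 2"] \<open>\<epsilon> > 0\<close> by (metis half_gt_zero)
    have "norm (b (n + int K) - b n) \<le> \<epsilon> / 2"
    proof (rule tendsto_upperbound[OF tendsto_norm[OF tendsto_diff[OF lim lim]]])
      show "\<forall>\<^sub>F j in sequentially. norm (psp_coeff \<rho> (int (nat (n + int K + int (k j))))
          - psp_coeff \<rho> (int (nat (n + int (k j))))) \<le> \<epsilon> / 2"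
      proof (rule eventually_sequentiallyI[of "nat (- n)"])
        fix j assume "j \<ge> nat (- n)"
        with seq_suble[OF mono, of j] have "n + int (k j) \<ge> 0" by linarith
        then show "norm (psp_coeff \<rho> (int (nat (n + int K + int (k j))))
            - psp_coeff \<rho> (int (nat (n + int (k j))))) \<le> \<epsilon> / 2"
          using K(2)[of "n + int (k j)"] by (simp add: add_ac)
      qed
    qed simp
    moreover have "b (n + int K) = psp_coeff \<rho> (n + int K)"
      using b[of "nat (n + int K)"] K(1) by (simp split: if_splits)
    ultimately have "dist (b n) (psp_coeff \<rho> (n + int K)) \<le> \<epsilon> / 2"
      by (simp add: dist_norm norm_minus_commute)
    then show ?thesis
      using K(2)[of n] dist_triangle[of "b n" "psp_coeff \<rho> n" "psp_coeff \<rho> (n + int K)"]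
      by (simp add: dist_norm)
  qed
  then have "norm (b n - psp_coeff \<rho> n) \<le> 0" by (metis add_0 field_le_epsilon)
  then show "b n = psp_coeff \<rho> n" by simp
qed

end

theorem theorem1p1:
  fixes \<rho> :: "complex \<Rightarrow> complex"
  assumes "(\<lambda>l. norm (\<rho> l)) summable_on unit_circle"
  shows "uniquely_rrl_continuable (psp_inner \<rho>) \<and> rrl_continuation (psp_inner \<rho>) (psp_outer \<rho>)"
proof -
  have cont: "rrl_continuation (psp_inner \<rho>) (psp_outer \<rho>)"
    unfolding rrl_continuation_def
    using bounded_power_series_psp_inner[OF assms] renascent_psp_coeff[OF assms]
      outer_series_psp_coeff[OF assms] by metis
  \<comment> \<open>The function \<open>h\<close> determines neither witness directly; the
    coefficients are forced first, then the right limit, and so \<open>h\<close>.\<close>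
  moreover have "h = psp_outer \<rho>" if "rrl_continuation (psp_inner \<rho>) h" for h
    using that bounded_power_series_psp_inner_unique[OF assms] renascent_psp_coeff_unique[OF assms]
      outer_series_psp_coeff[OF assms] unfolding rrl_continuation_def by metis
  moreover have "rrl_continuable (psp_inner \<rho>)"
    using cont unfolding rrl_continuation_def rrl_continuable_def by blast
  ultimately show ?thesis unfolding uniquely_rrl_continuable_def by blast
qed

end
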